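(* Let $a:[0,+\infty)\to[0,+\infty)$ be an interaction function such that $\lim_{s\to 0}s\,a(s)=+\infty$ (limit over $s>0$). Then for all $M>0$ there exists $\epsilon>0$ such that if $\|x_i(0)-x_j(0)\|<\epsilon$ for all $(i,j)\in\{1,\dots,N\}^2$, then for any control $u\in U_M$, the solution of $$\dot x_i=\frac1N\sum_{j\neq i}a(\|x_i-x_j\|)(x_j-x_i)+u_i,\quad i\in\{1,\dots,N\},$$ converges to consensus in finite time. In other words, for any $M>0$, the black hole region $\mathcal{R}^M_{\mathrm{BH}}$ satisfies $\mathcal{M}_c\subsetneq\mathcal{R}^M_{\mathrm{BH}}$.
   Context: $N\ge2$ agents, states $x_i(t)\in\mathbb{R}^d$, $\|\cdot\|$ is the Euclidean norm. $U_M=\{u:\mathbb{R}^+\to(\mathbb{R}^d)^N \text{ measurable}: \sum_{i=1}^N\|u_i(t)\|\leq M\text{ for a.e. }t\}$. Since $a$ may be unbounded near $0$, the convention $a(0)=0$ is imposed in the differential equation, and solutions are extended by continuity after each time at which agents collide. $\phi_{a,u}(x_0,t)$ denotes the solution at time $t$ with $x(0)=x_0$ (flow of the controlled system). Variance: $V(x)=\frac{1}{2N^2}\sum_{i=1}^N\sum_{j=i+1}^N\|x_i-x_j\|^2$. Consensus is the state $x_1=\dots=x_N$, equivalently $V(x)=0$; $\mathcal{M}_c=\{x\in(\mathbb{R}^d)^N: x_j=x_k\ \forall j,k\}$. Black hole region: $\mathcal{R}^M_{\mathrm{BH}}=\{x_0\in(\mathbb{R}^d)^N:\ \forall u\in U_M,\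 \exists T>0,\ V(\phi_{a,u}(x_0,T))=0\}$. *)

theory Defs
  imports "HOL-Analysis.Analysis"
begin

text \<open>
  The $N$ agents are indexed by a finite linearly ordered type \<open>'n\<close> and live in
  $\mathbb{R}^d$ with $d$ the cardinality of \<open>'d\<close>, so a configuration is a term of type
  \<open>real^'d^'n\<close>. The order on \<open>'n\<close> serves only to write sums over pairs $i < j$.
\<close>

definition variance :: "real^'d^('n::{finite,linorder}) \<Rightarrow> real" where
  "variance x = 1 / (2 * real CARD('n) ^ 2) *
     (\<Sum>i\<in>UNIV. \<Sum>j\<in>{i<..}. norm (x $ i - x $ j) ^ 2)"

definition consensus :: "(real^'d^('n::{finite,linorder})) set" where
  "consensus = {x. \<forall>j k. x $ j = x $ k}"

definition admissible :: "real \<Rightarrow> (real \<Rightarrow> real^'d^('n::{finite,linorder})) set" where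
  "admissible M = {u. u \<in> borel_measurable (lebesgue_on {0..}) \<and>
     (AE t in lebesgue_on {0..}. (\<Sum>i\<in>UNIV. norm (u t $ i)) \<le> M)}"

text \<open>The convention $a(0) = 0$, applied in the differential equation only.\<close>

definition kernel :: "(real \<Rightarrow> real) \<Rightarrow> real \<Rightarrow> real" where
  "kernel a s = (if s = 0 then 0 else a s)"

definition rhs ::
  "(real \<Rightarrow> real) \<Rightarrow> real^'d^('n::{finite,linorder}) \<Rightarrow>
   real^'d^('n::{finite,linorder}) \<Rightarrow> real^'d^('n::{finite,linorder})" where
  "rhs a w x = (\<chi> i. (1 / real CARD('n)) *\<^sub>R
     (\<Sum>j\<in>UNIV - {i}. kernel a (norm (x $ i - x $ j)) *\<^sub>R (x $ j - x $ i)) + w $ i)"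

definition cluster :: "real^'d^('n::{finite,linorder}) \<Rightarrow> 'n \<Rightarrow> 'n set" where
  "cluster x i = {k. x $ k = x $ i}"

text \<open>
  Solutions on $[0,\infty)$ are locally absolutely continuous curves, given by their
  velocity \<open>v\<close>, and the equation holds for almost every time. An agent that
  is not collided satisfies its own equation, its cluster being a singleton.

  For collided agents only the sum of their equations is required. This is how a solution
  is continued past a collision: an attraction with $s\,a(s) \to +\infty$ keeps
  collided agents together even if their controls differ, whereas the separate equations
  with $a(0) = 0$ would require $0 = \dot x_i - \dot x_j = u_i - u_j$ for almost every time at
  which $x_i = x_j$, and then no curve continues the solution if $u_i \ne u_j$. The forces
  between members of a cluster cancel in the sum, and members of a cluster have the same
  velocity at almost every time they coincide, so the cluster moves with the mean of the
  right-hand sides. Every solution of the separate equations is a solution in this sense,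
  and the two notions agree as long as no agents collide; see the two lemmas below.
\<close>

definition is_solution ::
  "(real \<Rightarrow> real) \<Rightarrow> (real \<Rightarrow> real^'d^('n::{finite,linorder})) \<Rightarrow>
   real^'d^('n::{finite,linorder}) \<Rightarrow> (real \<Rightarrow> real^'d^('n::{finite,linorder})) \<Rightarrow> bool" where
  "is_solution a u x0 x \<longleftrightarrow> (\<exists>v.
     (\<forall>t\<ge>0. v absolutely_integrable_on {0..t} \<and> x t = x0 + integral {0..t} v) \<and>
     (AE t in lebesgue_on {0..}. \<forall>i.
        (\<Sum>k\<in>cluster (x t) i. v t $ k) = (\<Sum>k\<in>cluster (x t) i. rhs a (u t) (x t) $ k)))"

lemma is_solution_if_caratheodory:
  assumes "\<And>t. t \<ge> 0 \<Longrightarrow> v absolutely_integrable_on {0..t} \<and> x t = x0 + integral {0..t} v"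
    and "AE t in lebesgue_on {0..}. v t = rhs a (u t) (x t)"
  shows "is_solution a u x0 x"
  unfolding is_solution_def
proof (intro exI conjI)
  show "AE t in lebesgue_on {0..}. \<forall>i.
      (\<Sum>k\<in>cluster (x t) i. v t $ k) = (\<Sum>k\<in>cluster (x t) i. rhs a (u t) (x t) $ k)"
    using assms(2) by eventually_elim simp
qed (use assms(1) in blast)

lemma caratheodory_if_is_solution:
  assumes "is_solution a u x0 x"
    and inj: "\<And>t i j. t \<ge> 0 \<Longrightarrow> x t $ i = x t $ j \<Longrightarrow> i = j"
  shows "\<exists>v. (\<forall>t\<ge>0. v absolutely_integrable_on {0..t} \<and> x t = x0 + integral {0..t} v) \<and>
    (AE t in lebesgue_on {0..}. v t = rhs a (u t) (x t))"
proof -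
  obtain v where v: "\<forall>t\<ge>0. v absolutely_integrable_on {0..t} \<and> x t = x0 + integral {0..t} v"
    and ae: "AE t in lebesgue_on {0..}. \<forall>i.
      (\<Sum>k\<in>cluster (x t) i. v t $ k) = (\<Sum>k\<in>cluster (x t) i. rhs a (u t) (x t) $ k)"
    using assms(1) unfolding is_solution_def by blast
  have "AE t in lebesgue_on {0..}. v t = rhs a (u t) (x t)"
    using ae AE_space
  proof eventually_elim
    case (elim t)
    then have "t \<ge> 0" by simp
    then have "cluster (x t) i = {i}" for i
      using inj[of t] by (auto simp: cluster_def)
    with elim show ?case by (simp add: vec_eq_iff)
  qed
  with v show ?thesis by blast
qed

text \<open>
  No regularity of \<open>a\<close> is assumed that would make the flow well defined, so
  ``the solution'' from \<open>x0\<close> is read as every solution from \<open>x0\<close>.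
\<close>

definition black_hole :: "(real \<Rightarrow> real) \<Rightarrow> real \<Rightarrow> (real^'d^('n::{finite,linorder})) set" where
  "black_hole a M = {x0. \<forall>u\<in>admissible M. \<forall>x. is_solution a u x0 x \<longrightarrow>
     (\<exists>T>0. variance (x T) = 0)}"

end

theory Submission
  imports Defs
begin

text \<open>
  Let $z_i = x_i - \bar x$ be the deviation of the agents from their mean. It is constant on
  clusters, so summing $z_i \cdot \dot x_i$ only involves the cluster sums of the velocities, and
  those are prescribed by the equation. If $s\,a(s) \ge 2(M+1)$ for $0 < s < \delta$, then
  $\frac{d}{dt}\|z\|^2 \le -2\|z\|$ for almost every time at which $\|z\| < \delta/2$; the attraction
  dominates any control. By a barrier argument the bound $\|z\| < \delta/2$ persists,
  and the differential inequality drives $\|z\|$ to zero by time $\delta$.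
\<close>

section \<open>Chain rule for the squared norm of an absolutely continuous curve\<close>

lemma norm_power2_indefinite_integral:
  fixes z v :: "real \<Rightarrow> 'a::euclidean_space"
  assumes "a \<le> b" and v: "v absolutely_integrable_on {a..b}"
    and z: "\<And>t. t \<in> {a..b} \<Longrightarrow> z t = z0 + integral {a..t} v"
  shows "((\<lambda>t. 2 * (z t \<bullet> v t)) has_integral (norm (z b))\<^sup>2 - (norm (z a))\<^sup>2) {a..b}"
proof -
  \<comment> \<open>No Lebesgue differentiation is needed: the error of the identity is additive over adjacent
    intervals and locally bounded by $4e \int \|v\|$ for every $e > 0$, hence it vanishes.\<close>
  have v_int: "v integrable_on {a..b}" and nv_int: "(\<lambda>t. norm (v t)) integrable_on {a..b}"
    using v by (auto simp: absolutely_integrable_on_def)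
  have cont: "continuous_on {a..b} z"
    using continuous_on_add[OF continuous_on_const indefinite_integral_continuous_1[OF v_int]]
    by (rule continuous_on_eq) (use z in auto)
  have "(\<lambda>t. z t \<bullet> v t) absolutely_integrable_on {a..b}"
    by (rule absolutely_integrable_bounded_measurable_product)
       (use v cont in \<open>auto simp: bilinear_conv_bounded_bilinear bounded_bilinear_inner
          intro: continuous_imp_measurable_on_sets_lebesgue compact_imp_bounded compact_continuous_image\<close>)
  then have zv_int: "(\<lambda>t. 2 * (z t \<bullet> v t)) integrable_on {a..b}"
    by (intro integrable_on_mult_right) (auto simp: absolutely_integrable_on_def)
  define I where "I = integral {a..b} (\<lambda>t. norm (v t))"
  have "I \<ge> 0"
    unfolding I_def by (rule integral_nonneg[OF nv_int]) simp
  have "\<bar>(norm (z b))\<^sup>2 - (norm (z a))\<^sup>2 - integral {a..b} (\<lambda>t. 2 * (z t \<bullet> v t))\<bar> \<le> 4 * e * I"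
    if "e > 0" for e
  proof -
    let ?D = "\<lambda>p q. (norm (z q))\<^sup>2 - (norm (z p))\<^sup>2 - integral {p..q} (\<lambda>t. 2 * (z t \<bullet> v t))"
    let ?L = "\<lambda>p q. integral {p..q} (\<lambda>t. norm (v t))"
    \<comment> \<open>The condition that the interval lies in \<open>{a..b}\<close> is part of the
      predicate, because \<open>Bolzano\<close> hands over intervals that may reach beyond
      it.\<close>
    have "a \<le> a \<longrightarrow> b \<le> b \<longrightarrow> \<bar>?D a b\<bar> \<le> 4 * e * ?L a b"
      using \<open>a \<le> b\<close>
    proof (rule Bolzano[where P = "\<lambda>p q. a \<le> p \<longrightarrow> q \<le> b \<longrightarrow> \<bar>?D p q\<bar> \<le> 4 * e * ?L p q"])
      fix p q r
      assume pq: "a \<le> p \<longrightarrow> q \<le> b \<longrightarrow> \<bar>?D p q\<bar> \<le> 4 * e * ?L p q"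
        and qr: "a \<le> q \<longrightarrow> r \<le> b \<longrightarrow> \<bar>?D q r\<bar> \<le> 4 * e * ?L q r" and "p \<le> q" "q \<le> r"
      show "a \<le> p \<longrightarrow> r \<le> b \<longrightarrow> \<bar>?D p r\<bar> \<le> 4 * e * ?L p r"
      proof (intro impI)
        assume "a \<le> p" "r \<le> b"
        then have sub: "{p..r} \<subseteq> {a..b}" by auto
        have "?L p q + ?L q r = ?L p r"
          by (rule Henstock_Kurzweil_Integration.integral_combine[OF \<open>p \<le> q\<close> \<open>q \<le> r\<close> integrable_on_subinterval[OF nv_int sub]])
        moreover have "?D p q + ?D q r = ?D p r"
          using Henstock_Kurzweil_Integration.integral_combine[OF \<open>p \<le> q\<close> \<open>q \<le> r\<close> integrable_on_subinterval[OF zv_int sub]] by simp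
        moreover have "\<bar>?D p q\<bar> \<le> 4 * e * ?L p q" "\<bar>?D q r\<bar> \<le> 4 * e * ?L q r"
          using pq qr \<open>a \<le> p\<close> \<open>r \<le> b\<close> \<open>p \<le> q\<close> \<open>q \<le> r\<close> by auto
        ultimately have "\<bar>?D p r\<bar> \<le> 4 * e * ?L p q + 4 * e * ?L q r" and "?L p r = ?L p q + ?L q r"
          by linarith+
        then show "\<bar>?D p r\<bar> \<le> 4 * e * ?L p r"
          by (simp only: distrib_left)
      qed
    next
      fix s
      assume "a \<le> s" "s \<le> b"
      then obtain d where "d > 0" and d: "\<And>t. t \<in> {a..b} \<Longrightarrow> \<bar>t - s\<bar> < d \<Longrightarrow> norm (z t - z s) < e"
        using cont \<open>e > 0\<close> unfolding continuous_on_iff dist_norm real_norm_def by (metis atLeastAtMost_iff)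
      have "\<bar>?D p q\<bar> \<le> 4 * e * ?L p q"
        if "p \<le> s" "s \<le> q" "q - p < d" "a \<le> p" "q \<le> b" for p q
      proof -
        have sub: "{p..q} \<subseteq> {a..b}" using that by auto
        note v' = integrable_on_subinterval[OF v_int sub]
        note zv' = integrable_on_subinterval[OF zv_int sub]
        note nv' = integrable_on_subinterval[OF nv_int sub]
        have "{a..q} \<subseteq> {a..b}" using that by auto
        from integrable_on_subinterval[OF v_int this]
        have "integral {a..p} v + integral {p..q} v = integral {a..q} v"
          using that by (intro Henstock_Kurzweil_Integration.integral_combine) auto
        then have "z q - z p = integral {p..q} v"
          using z[of p] z[of q] that by (simp add: algebra_simps)
        \<comment> \<open>The increment of the square is the integral of \<open>v\<close> against
          the fixed vector \<open>z q + z p\<close>, while the integrand uses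
          \<open>2 * z t\<close>. Only the oscillation of \<open>z\<close> on a short interval
          enters the error.\<close>
        moreover have "(norm (z q))\<^sup>2 - (norm (z p))\<^sup>2 = (z q + z p) \<bullet> (z q - z p)"
          by (simp add: power2_norm_eq_inner inner_diff_right inner_add_left inner_commute[of "z p" "z q"])
        ultimately have "(norm (z q))\<^sup>2 - (norm (z p))\<^sup>2 = (z q + z p) \<bullet> integral {p..q} v"
          by simp
        also have "\<dots> = integral {p..q} (\<lambda>t. (z q + z p) \<bullet> v t)"
          using integral_linear[OF v' bounded_linear_inner_right, of "z q + z p"] by (simp add: o_def)
        finally have "?D p q = integral {p..q} (\<lambda>t. (z q + z p) \<bullet> v t - 2 * (z t \<bullet> v t))"
          using integral_diff[OF integrable_linear[OF v' bounded_linear_inner_right] zv', of "z q + z p"]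
          by (simp add: o_def)
        moreover have "norm (integral {p..q} (\<lambda>t. (z q + z p) \<bullet> v t - 2 * (z t \<bullet> v t)))
            \<le> integral {p..q} (\<lambda>t. 4 * e * norm (v t))"
        proof (rule integral_norm_bound_integral)
          show "(\<lambda>t. (z q + z p) \<bullet> v t - 2 * (z t \<bullet> v t)) integrable_on {p..q}"
            using integrable_diff[OF integrable_linear[OF v' bounded_linear_inner_right] zv', of "z q + z p"]
            by (simp add: o_def)
          show "(\<lambda>t. 4 * e * norm (v t)) integrable_on {p..q}"
            using nv' by (rule integrable_on_mult_right)
          fix t assume t: "t \<in> {p..q}"
          \<comment> \<open>Comparing everything with \<open>z s\<close> leaves four distances below
            \<open>e\<close>: one at \<open>q\<close>, one at \<open>p\<close>, and the one at
            \<open>t\<close> twice. This is the factor 4.\<close>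
          have "z q + z p - 2 *\<^sub>R z t = (z q - z s) + (z p - z s) - 2 *\<^sub>R (z t - z s)"
            by (simp add: scaleR_2)
          also have "norm \<dots> \<le> norm (z q - z s) + norm (z p - z s) + 2 * norm (z t - z s)"
            using norm_triangle_ineq4[of "(z q - z s) + (z p - z s)" "2 *\<^sub>R (z t - z s)"]
              norm_triangle_ineq[of "z q - z s" "z p - z s"] by simp
          also have "\<dots> \<le> 4 * e"
          proof -
            have "\<bar>t - s\<bar> < d"
              using t that by (auto simp: abs_if)
            then show ?thesis
              using d[of q] d[of p] d[of t] t that by auto
          qed
          finally have "norm (z q + z p - 2 *\<^sub>R z t) * norm (v t) \<le> 4 * e * norm (v t)"
            by (rule mult_right_mono) simp
          moreover have "(z q + z p) \<bullet> v t - 2 * (z t \<bullet> v t) = (z q + z p - 2 *\<^sub>R z t) \<bullet> v t"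
            by (simp add: inner_diff_left)
          ultimately show "norm ((z q + z p) \<bullet> v t - 2 * (z t \<bullet> v t)) \<le> 4 * e * norm (v t)"
            using Cauchy_Schwarz_ineq2[of "z q + z p - 2 *\<^sub>R z t" "v t"] by simp
        qed
        ultimately show ?thesis by simp
      qed
      with \<open>d > 0\<close> show "\<exists>d>0. \<forall>p q. p \<le> s \<and> s \<le> q \<and> q - p < d \<longrightarrow>
          a \<le> p \<longrightarrow> q \<le> b \<longrightarrow> \<bar>?D p q\<bar> \<le> 4 * e * ?L p q"
        by blast
    qed
    then show ?thesis by (simp add: I_def)
  qed
  note bound = this
  \<comment> \<open>The summand 0 gives the shape that \<open>field_le_epsilon\<close> expects. The
    error is made small with \<open>e / (4 * (I + 1))\<close>, where \<open>I + 1\<close> avoids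
    division by zero if \<open>I = 0\<close>.\<close>
  have "\<bar>(norm (z b))\<^sup>2 - (norm (z a))\<^sup>2 - integral {a..b} (\<lambda>t. 2 * (z t \<bullet> v t))\<bar> \<le> 0 + e" if "e > 0" for e
  proof -
    have "4 * (e / (4 * (I + 1))) * I = e * (I / (I + 1))"
      using \<open>I \<ge> 0\<close> by (simp add: field_simps)
    also have "\<dots> \<le> e * 1"
      using \<open>I \<ge> 0\<close> \<open>e > 0\<close> by (intro mult_left_mono) auto
    finally show ?thesis
      using bound[of "e / (4 * (I + 1))"] \<open>e > 0\<close> \<open>I \<ge> 0\<close> by simp
  qed
  then have "\<bar>(norm (z b))\<^sup>2 - (norm (z a))\<^sup>2 - integral {a..b} (\<lambda>t. 2 * (z t \<bullet> v t))\<bar> \<le> 0"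
    by (rule field_le_epsilon)
  then show ?thesis
    using zv_int by (simp add: has_integral_iff)
qed

section \<open>Extinction in finite time from an integrated decay inequality\<close>

text \<open>
  If $f(s) \le B$ then $f(s + B) \le B/2$, and the waiting times $A, A/2, A/4, \dots$ sum to $2A$.
\<close>

lemma extinction_by_halving:
  fixes f :: "real \<Rightarrow> real"
  assumes nonneg: "\<And>t. t \<ge> 0 \<Longrightarrow> f t \<ge> 0" and "f 0 \<le> A"
    and decay: "\<And>s t. 0 \<le> s \<Longrightarrow> s \<le> t \<Longrightarrow> (f t)\<^sup>2 + 2 * (t - s) * f t \<le> (f s)\<^sup>2"
  shows "f (2 * A) = 0"
proof -
  have "A \<ge> 0"
    using nonneg[of 0] \<open>f 0 \<le> A\<close> by simp
  have mono: "f t \<le> f s" if "0 \<le> s" "s \<le> t" for s t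
  proof (rule power2_le_imp_le)
    have "2 * (t - s) * f t \<ge> 0"
      using that nonneg[of t] by simp
    then show "(f t)\<^sup>2 \<le> (f s)\<^sup>2"
      using decay[OF that] by linarith
  qed (use that nonneg in simp)
  \<comment> \<open>Over a waiting time \<open>B\<close>, a value above \<open>B / 2\<close> at the
    end would make the linear term of \<open>decay\<close> at least \<open>B * B\<close>, all that
    \<open>f s\<close> has to spend. The positive square of the end value is then too much.\<close>
  have half: "f (s + B) \<le> B / 2" if "0 \<le> s" "f s \<le> B" for s B
  proof (rule ccontr)
    assume "\<not> f (s + B) \<le> B / 2"
    moreover have "B \<ge> 0"
      using that nonneg[of s] by simp
    ultimately have gt: "f (s + B) > B / 2" "f (s + B) > 0"
      by auto
    have "B * B \<le> 2 * B * f (s + B)"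
      using gt \<open>B \<ge> 0\<close> by (simp add: mult_left_mono mult.assoc mult.left_commute)
    moreover have "(f (s + B))\<^sup>2 > 0"
      using gt by simp
    moreover have "(f s)\<^sup>2 \<le> B * B"
      using that nonneg[of s] by (simp add: power2_eq_square mult_mono)
    moreover have "(f (s + B))\<^sup>2 + 2 * B * f (s + B) \<le> (f s)\<^sup>2"
      using decay[of s "s + B"] that \<open>B \<ge> 0\<close> by simp
    ultimately show False
      by linarith
  qed
  \<comment> \<open>The time on the left is the sum of the first \<open>n\<close> waiting
    times.\<close>
  have step: "f (2 * A * (1 - (1/2)^n)) \<le> A * (1/2)^n" for n
  proof (induction n)
    case 0
    show ?case using \<open>f 0 \<le> A\<close> by simp
  next
    case (Suc n)
    have "2 * A * (1 - (1/2)^n) \<ge> 0"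
      using \<open>A \<ge> 0\<close> by (simp add: power_le_one)
    from half[OF this Suc] show ?case
      by (simp add: algebra_simps)
  qed
  have "f (2 * A) \<le> A * (1/2)^n" for n
  proof -
    have "f (2 * A) \<le> f (2 * A * (1 - (1/2)^n))"
      using \<open>A \<ge> 0\<close> by (intro mono mult_left_le) (auto simp: power_le_one)
    then show ?thesis
      using step[of n] by linarith
  qed
  moreover have "(\<lambda>n. A * (1/2)^n) \<longlonglongrightarrow> A * 0"
    by (intro tendsto_mult tendsto_const LIMSEQ_power_zero) simp
  ultimately have "f (2 * A) \<le> A * 0"
    using LIMSEQ_le_const by blast
  then show ?thesis
    using nonneg[of "2 * A"] \<open>A \<ge> 0\<close> by simp
qed

section \<open>Cluster sums and the deviation from the mean\<close>

text \<open>Grouping the agents by position lets the common factor \<open>g p\<close> be pulled out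
  of each group, and what remains is a cluster sum. For solutions \<open>g\<close> will be
  subtraction of the mean.\<close>

lemma sum_inner_cluster:
  fixes x v w :: "real^'d^('n::{finite,linorder})"
  assumes "\<And>i. (\<Sum>k\<in>cluster x i. v $ k) = (\<Sum>k\<in>cluster x i. w $ k)"
  shows "(\<Sum>i\<in>UNIV. g (x $ i) \<bullet> v $ i) = (\<Sum>i\<in>UNIV. g (x $ i) \<bullet> w $ i)"
proof -
  have split: "(\<Sum>i\<in>UNIV. g (x $ i) \<bullet> v $ i) = (\<Sum>p\<in>range (($) x). g p \<bullet> (\<Sum>i | x $ i = p. v $ i))"
    for v :: "real^'d^('n::{finite,linorder})"
    by (subst sum.image_gen[of UNIV _ "($) x"]) (auto simp: inner_sum_right intro!: sum.cong)
  have "(\<Sum>i | x $ i = p. v $ i) = (\<Sum>i | x $ i = p. w $ i)" if "p \<in> range (($) x)" for p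
    using that assms by (auto simp: cluster_def)
  then show ?thesis
    by (simp add: split)
qed

definition mean :: "real^'d^'n \<Rightarrow> real^'d" where
  "mean x = (1 / real CARD('n)) *\<^sub>R (\<Sum>i\<in>UNIV. x $ i)"

definition deviation :: "real^'d^'n \<Rightarrow> real^'d^'n" where
  "deviation x = (\<chi> i. x $ i - mean x)"

text \<open>Linearity lets \<open>deviation\<close> pass under the integral, so the deviation of a
  solution is again an indefinite integral.\<close>

lemma linear_deviation: "linear deviation"
  by (rule linearI)
     (auto simp: deviation_def mean_def vec_eq_iff sum.distrib scaleR_add_right scaleR_diff_right
       scaleR_sum_right algebra_simps sum_distrib_left)

lemma sum_deviation: "(\<Sum>i\<in>UNIV. deviation (x :: real^'d^'n) $ i) = 0"
  by (simp add: deviation_def mean_def sum_subtractf sum_constant_scaleR del: sum_constant)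

text \<open>\<open>deviation\<close> is the orthogonal projection onto configurations with sum zero:
  \<open>y\<close> and \<open>deviation y\<close> differ by a configuration with all entries equal
  to \<open>mean y\<close>, which is orthogonal to these. Thus the velocity itself may replace its
  deviation in the energy estimate.\<close>

lemma deviation_inner_deviation: "deviation x \<bullet> deviation y = deviation x \<bullet> (y :: real^'d^'n)"
proof -
  have "deviation x \<bullet> deviation y = deviation x \<bullet> y - (\<Sum>i\<in>UNIV. deviation x $ i \<bullet> mean y)"
    by (simp add: inner_vec_def[of "deviation x"] deviation_def[of y] inner_diff_right sum_subtractf)
  then show ?thesis
    by (simp add: sum_deviation flip: inner_sum_left)
qed

lemma deviation_diff: "deviation x $ i - deviation x $ j = x $ i - x $ j"
  by (simp add: deviation_def)

lemma norm_diff_le_deviation: "norm (x $ i - x $ j) \<le> 2 * norm (deviation x)"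
  using norm_triangle_ineq4[of "deviation x $ i" "deviation x $ j"]
    Finite_Cartesian_Product.norm_nth_le[of "deviation x" i]
    Finite_Cartesian_Product.norm_nth_le[of "deviation x" j]
  by (simp add: deviation_diff)

text \<open>The deviation of an agent is the average of its differences to all agents.\<close>

lemma norm_deviation_nth_le:
  "norm (deviation (x :: real^'d^'n) $ i) \<le> (1 / real CARD('n)) * (\<Sum>j\<in>UNIV. norm (x $ i - x $ j))"
proof -
  have "deviation x $ i = (1 / real CARD('n)) *\<^sub>R (\<Sum>j\<in>UNIV. x $ i - x $ j)"
    by (simp add: deviation_def mean_def sum_subtractf scaleR_diff_right sum_constant_scaleR del: sum_constant)
  then show ?thesis
    by (simp add: norm_sum divide_right_mono)
qed

lemma norm_deviation_le:
  "norm (deviation (x :: real^'d^'n)) \<le> (1 / real CARD('n)) * (\<Sum>i\<in>UNIV. \<Sum>j\<in>UNIV. norm (x $ i - x $ j))"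
proof -
  have "norm (deviation x) \<le> (\<Sum>i\<in>UNIV. norm (deviation x $ i))"
    unfolding norm_vec_def by (rule L2_set_le_sum) simp
  also have "\<dots> \<le> (\<Sum>i\<in>UNIV. (1 / real CARD('n)) * (\<Sum>j\<in>UNIV. norm (x $ i - x $ j)))"
    by (intro sum_mono norm_deviation_nth_le)
  finally show ?thesis
    by (simp add: sum_distrib_left)
qed

text \<open>The form with norms rewrites the distances in \<open>variance\<close> and in the bounds
  above directly to 0.\<close>

lemma consensus_iff: "x \<in> consensus \<longleftrightarrow> (\<forall>i j. norm (x $ i - x $ j) = 0)"
  by (auto simp: consensus_def)

lemma deviation_eq_0_iff: "deviation x = 0 \<longleftrightarrow> x \<in> consensus"
proof
  assume "deviation x = 0"
  then show "x \<in> consensus"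
    using deviation_diff[of x] by (simp add: consensus_iff)
next
  assume "x \<in> consensus"
  then have "norm (deviation x) \<le> 0"
    using norm_deviation_le[of x] by (simp only: consensus_iff sum.neutral_const mult_zero_right)
  then show "deviation x = 0" by simp
qed

section \<open>Attraction against control\<close>

text \<open>The factor $1/2$ comes from symmetrizing the double sum in $i$ and $j$.\<close>

lemma deviation_inner_rhs:
  fixes x w :: "real^'d^('n::{finite,linorder})"
  shows "deviation x \<bullet> rhs a w x = deviation x \<bullet> w -
    (1 / (2 * real CARD('n))) * (\<Sum>i\<in>UNIV. \<Sum>j\<in>UNIV. kernel a (norm (x $ i - x $ j)) * (norm (x $ i - x $ j))\<^sup>2)"
proof -
  let ?z = "deviation x" and ?k = "\<lambda>i j. kernel a (norm (x $ i - x $ j))"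
  let ?S = "\<Sum>i\<in>UNIV. \<Sum>j\<in>UNIV. ?k i j * (?z $ i \<bullet> (x $ j - x $ i))"
  \<comment> \<open>The diagonal term vanishes. Including it makes both indices range over all
    agents, so that the sums can be swapped.\<close>
  have "(\<Sum>j\<in>UNIV - {i}. ?k i j *\<^sub>R (x $ j - x $ i)) = (\<Sum>j\<in>UNIV. ?k i j *\<^sub>R (x $ j - x $ i))" for i
    by (rule sum.mono_neutral_left) auto
  then have "?z \<bullet> rhs a w x = (1 / real CARD('n)) * ?S + ?z \<bullet> w"
    by (simp add: inner_vec_def[of ?z] rhs_def inner_add_right sum.distrib inner_sum_right sum_divide_distrib)
  moreover have "2 * ?S = - (\<Sum>i\<in>UNIV. \<Sum>j\<in>UNIV. ?k i j * (norm (x $ i - x $ j))\<^sup>2)"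
  proof -
    have "?S = (\<Sum>i\<in>UNIV. \<Sum>j\<in>UNIV. ?k j i * (?z $ j \<bullet> (x $ i - x $ j)))"
      by (rule sum.swap)
    then have "2 * ?S = (\<Sum>i\<in>UNIV. \<Sum>j\<in>UNIV.
        ?k i j * (?z $ i \<bullet> (x $ j - x $ i)) + ?k j i * (?z $ j \<bullet> (x $ i - x $ j)))"
      by (simp add: sum.distrib)
    also have "\<dots> = (\<Sum>i\<in>UNIV. \<Sum>j\<in>UNIV. - (?k i j * (norm (x $ i - x $ j))\<^sup>2))"
    proof (intro sum.cong refl)
      fix i j
      have "(norm (x $ i - x $ j))\<^sup>2 = (?z $ i - ?z $ j) \<bullet> (x $ i - x $ j)"
        by (simp add: deviation_diff power2_norm_eq_inner)
      then show "?k i j * (?z $ i \<bullet> (x $ j - x $ i)) + ?k j i * (?z $ j \<bullet> (x $ i - x $ j)) =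
          - (?k i j * (norm (x $ i - x $ j))\<^sup>2)"
        by (simp only: norm_minus_commute[of "x $ j"]) (simp add: inner_diff_left inner_diff_right algebra_simps)
    qed
    finally show ?thesis
      by (simp add: sum_negf)
  qed
  ultimately show ?thesis
    by (simp add: field_simps)
qed

text \<open>All terms are compared through the sum R of all pair distances. With the factor 1/(2N)
  of the symmetrized force, the threshold \<open>2 * (M + 1)\<close> yields an attraction of at
  least (M+1) R/N. The control uses up at most M R/N, and the remaining R/N is at least the norm of
  the deviation.\<close>

lemma dissipation:
  fixes x w :: "real^'d^('n::{finite,linorder})"
  assumes a: "\<And>s. 0 < s \<Longrightarrow> s < \<delta> \<Longrightarrow> s * a s \<ge> 2 * (M + 1)"
    and w: "(\<Sum>i\<in>UNIV. norm (w $ i)) \<le> M"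
    and x: "norm (deviation x) < \<delta> / 2"
  shows "deviation x \<bullet> rhs a w x \<le> - norm (deviation x)"
proof -
  let ?R = "\<Sum>i\<in>UNIV. \<Sum>j\<in>UNIV. norm (x $ i - x $ j)" and ?N = "real CARD('n)"
  have "?R \<ge> 0"
    by (intro sum_nonneg) auto
  have "deviation x \<bullet> w \<le> (\<Sum>i\<in>UNIV. norm (deviation x $ i) * norm (w $ i))"
    unfolding inner_vec_def[of "deviation x"] by (intro sum_mono norm_cauchy_schwarz)
  \<comment> \<open>One row of pair distances is enlarged to all of R, so the bound is the same for
    every agent and the total control, at most \<open>M\<close>, factors out.\<close>
  also have "\<dots> \<le> (\<Sum>i\<in>UNIV. ((1 / ?N) * ?R) * norm (w $ i))"
  proof (intro sum_mono mult_right_mono)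
    fix i
    have "(\<Sum>j\<in>UNIV. norm (x $ i - x $ j)) \<le> ?R"
      by (rule member_le_sum[where f = "\<lambda>i. \<Sum>j\<in>UNIV. norm (x $ i - x $ j)"]) (auto intro: sum_nonneg)
    then show "norm (deviation x $ i) \<le> (1 / ?N) * ?R"
      using norm_deviation_nth_le[of x i] by (smt (verit) mult_left_mono of_nat_0_le_iff divide_nonneg_nonneg)
  qed simp
  also have "\<dots> \<le> ((1 / ?N) * ?R) * M"
    using w \<open>?R \<ge> 0\<close> unfolding sum_distrib_left[symmetric] by (intro mult_left_mono) auto
  finally have control: "deviation x \<bullet> w \<le> (1 / ?N) * ?R * M" .
  have "(\<Sum>i\<in>UNIV. \<Sum>j\<in>UNIV. 2 * (M + 1) * norm (x $ i - x $ j)) \<le>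
      (\<Sum>i\<in>UNIV. \<Sum>j\<in>UNIV. kernel a (norm (x $ i - x $ j)) * (norm (x $ i - x $ j))\<^sup>2)"
  proof (intro sum_mono)
    fix i j
    let ?r = "norm (x $ i - x $ j)"
    show "2 * (M + 1) * ?r \<le> kernel a ?r * ?r\<^sup>2"
    \<comment> \<open>For coincident agents both sides are 0, so the convention a(0) = 0 loses
      nothing.\<close>
    proof (cases "?r = 0")
      case False
      then have "?r > 0" by simp
      \<comment> \<open>The radius \<open>\<delta> / 2\<close> for the deviation is chosen for this:
        pair distances are at most twice the deviation.\<close>
      moreover have "?r < \<delta>"
        using norm_diff_le_deviation[of x i j] x by simp
      ultimately have "2 * (M + 1) * ?r \<le> ?r * a ?r * ?r"
        by (intro mult_right_mono a) auto
      then show ?thesis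
        using \<open>?r > 0\<close> by (simp add: kernel_def power2_eq_square mult_ac)
    qed simp
  qed
  then have "2 * (M + 1) * ?R \<le> (\<Sum>i\<in>UNIV. \<Sum>j\<in>UNIV. kernel a (norm (x $ i - x $ j)) * (norm (x $ i - x $ j))\<^sup>2)"
    by (simp add: sum_distrib_left)
  then have "(1 / (2 * ?N)) * (2 * (M + 1) * ?R) \<le>
      (1 / (2 * ?N)) * (\<Sum>i\<in>UNIV. \<Sum>j\<in>UNIV. kernel a (norm (x $ i - x $ j)) * (norm (x $ i - x $ j))\<^sup>2)"
    by (intro mult_left_mono) auto
  moreover have "(1 / (2 * ?N)) * (2 * (M + 1) * ?R) = (1 / ?N) * ?R * M + (1 / ?N) * ?R"
    by (simp add: field_simps)
  ultimately have "deviation x \<bullet> rhs a w x \<le> - ((1 / ?N) * ?R)"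
    using control unfolding deviation_inner_rhs by linarith
  then show ?thesis
    using norm_deviation_le[of x] by linarith
qed

section \<open>Decay along solutions and arrival at consensus\<close>

text \<open>This is the integrated form of (|z|^2)' <= -2 |z|. Since |z| is nonincreasing, its value
  at the right end bounds it from below on the whole interval, which gives the linear term.\<close>

lemma is_solution_deviation_decay:
  fixes x u :: "real \<Rightarrow> real^'d^('n::{finite,linorder})"
  assumes a: "\<And>s. 0 < s \<Longrightarrow> s < \<delta> \<Longrightarrow> s * a s \<ge> 2 * (M + 1)"
    and u: "u \<in> admissible M" and sol: "is_solution a u x0 x"
    and x0: "norm (deviation x0) < \<delta> / 2" and "0 \<le> s" "s \<le> t"
  shows "(norm (deviation (x t)))\<^sup>2 + 2 * (t - s) * norm (deviation (x t)) \<le> (norm (deviation (x s)))\<^sup>2"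
proof -
  define z where "z = (\<lambda>t. deviation (x t))"
  obtain v where v: "\<And>t. t \<ge> 0 \<Longrightarrow> v absolutely_integrable_on {0..t}"
    and x: "\<And>t. t \<ge> 0 \<Longrightarrow> x t = x0 + integral {0..t} v"
    and ode: "AE t in lebesgue_on {0..}. \<forall>i.
      (\<Sum>k\<in>cluster (x t) i. v t $ k) = (\<Sum>k\<in>cluster (x t) i. rhs a (u t) (x t) $ k)"
    using sol unfolding is_solution_def by blast
  define w where "w = (\<lambda>t. deviation (v t))"
  have bl: "bounded_linear (deviation :: real^'d^('n::{finite,linorder}) \<Rightarrow> _)"
    using linear_deviation by (simp add: linear_conv_bounded_linear)
  have w: "w absolutely_integrable_on {0..t}" if "t \<ge> 0" for t
    using absolutely_integrable_linear[OF v[OF that] bl] by (simp add: w_def o_def)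
  then have w_int: "w integrable_on {0..t}" if "t \<ge> 0" for t
    using that by (simp add: absolutely_integrable_on_def)
  have z: "z t = deviation x0 + integral {0..t} w" if "t \<ge> 0" for t
  proof -
    have "v integrable_on {0..t}"
      using v[OF that] by (simp add: absolutely_integrable_on_def)
    from integral_linear[OF this bl] show ?thesis
      unfolding z_def x[OF that] linear_add[OF linear_deviation] w_def o_def by simp
  qed
  have z_diff: "z t = z s + integral {s..t} w" if "0 \<le> s" "s \<le> t" for s t
  proof -
    have "t \<ge> 0"
      using that by simp
    from Henstock_Kurzweil_Integration.integral_combine[OF that w_int[OF this]]
    show ?thesis
      unfolding z[OF \<open>0 \<le> s\<close>] z[OF \<open>0 \<le> t\<close>] by (simp add: add.assoc)
  qed
  have energy: "((\<lambda>t. 2 * (z t \<bullet> w t)) has_integral (norm (z t))\<^sup>2 - (norm (z s))\<^sup>2) {s..t}"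
    if "0 \<le> s" "s \<le> t" for s t
  proof (rule norm_power2_indefinite_integral)
    show "w absolutely_integrable_on {s..t}"
      using that by (intro absolutely_integrable_on_subinterval[OF w[of t]]) auto
    show "z r = z s + integral {s..r} w" if "r \<in> {s..t}" for r
      using that \<open>0 \<le> s\<close> by (intro z_diff) auto
  qed (fact \<open>s \<le> t\<close>)
  have cont: "continuous_on {0..t} (\<lambda>t. norm (z t))" if "t \<ge> 0" for t
    using indefinite_integral_continuous_1[OF w_int[OF that]]
    by (rule continuous_on_eq[OF continuous_on_norm[OF continuous_on_add[OF continuous_on_const]]])
       (use z in auto)
  have "AE t in lebesgue_on {0..}. norm (z t) < \<delta> / 2 \<longrightarrow> z t \<bullet> w t \<le> - norm (z t)"
    using ode u[unfolded admissible_def, simplified, THEN conjunct2]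
  proof eventually_elim
    case (elim t)
    show ?case
    proof
      assume small: "norm (z t) < \<delta> / 2"
      have "z t \<bullet> w t = deviation (x t) \<bullet> v t"
        by (simp add: z_def w_def deviation_inner_deviation)
      \<comment> \<open>The velocity need not equal the right-hand side agent by agent. Equal
        cluster sums suffice, because the deviation of an agent depends only on its position once
        the mean is fixed.\<close>
      also have "\<dots> = deviation (x t) \<bullet> rhs a (u t) (x t)"
        using sum_inner_cluster[OF elim(1)[rule_format], of "\<lambda>p. p - mean (x t)"]
        by (simp add: inner_vec_def[of "deviation (x t)"]) (simp add: deviation_def)
      also have "\<dots> \<le> - norm (deviation (x t))"
        using a elim(2) small by (intro dissipation) (auto simp: z_def)
      finally show "z t \<bullet> w t \<le> - norm (z t)"
        by (simp add: z_def)
    qed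
  qed
  then have "AE t in lebesgue. t \<in> {0..} \<longrightarrow> norm (z t) < \<delta> / 2 \<longrightarrow> z t \<bullet> w t \<le> - norm (z t)"
    by (subst (asm) AE_restrict_space_iff) auto
  then obtain Z where "Z \<in> null_sets lebesgue"
    and Z': "\<And>t. t \<in> space lebesgue - Z \<Longrightarrow> t \<in> {0..} \<longrightarrow> norm (z t) < \<delta> / 2 \<longrightarrow> z t \<bullet> w t \<le> - norm (z t)"
    by (rule AE_E3) blast
  then have "negligible Z"
    by (simp add: negligible_iff_null_sets)
  have Z: "z t \<bullet> w t \<le> - norm (z t)" if "t \<ge> 0" "t \<notin> Z" "norm (z t) < \<delta> / 2" for t
    using Z'[of t] that by simp
  \<comment> \<open>The smallness is assumed only before \<open>t\<close>, so that this applies up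
    to a first exit time, where it fails. It is used with \<open>c = 0\<close> for monotonicity and
    with \<open>c = norm (z t)\<close> for the final estimate.\<close>
  have decay: "(norm (z t))\<^sup>2 - (norm (z s))\<^sup>2 \<le> (t - s) * (- 2 * c)"
    if "0 \<le> s" "s \<le> t" "c \<ge> 0" and c: "\<And>r. s \<le> r \<Longrightarrow> r < t \<Longrightarrow> norm (z r) < \<delta> / 2 \<and> c \<le> norm (z r)" for s t c
  proof -
    \<comment> \<open>On the exceptional set, including the end point, the integrand is replaced by
      the bound itself, so that the comparison holds at every point.\<close>
    have "((\<lambda>r. if r \<in> insert t Z then - 2 * c else 2 * (z r \<bullet> w r)) has_integral
        (norm (z t))\<^sup>2 - (norm (z s))\<^sup>2) {s..t}"
      by (rule has_integral_spike[OF _ _ energy[OF that(1,2)], of "insert t Z"])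
         (use \<open>negligible Z\<close> in simp_all)
    moreover have "((\<lambda>_. - 2 * c) has_integral (t - s) *\<^sub>R (- 2 * c)) {s..t}"
      using has_integral_const_real[of "- 2 * c" s t] that(2) by simp
    ultimately have "(norm (z t))\<^sup>2 - (norm (z s))\<^sup>2 \<le> (t - s) *\<^sub>R (- 2 * c)"
    proof (rule has_integral_le)
      fix r assume "r \<in> {s..t}"
      show "(if r \<in> insert t Z then - 2 * c else 2 * (z r \<bullet> w r)) \<le> - 2 * c"
      proof (cases "r \<in> insert t Z")
        case False
        then have "norm (z r) < \<delta> / 2" "c \<le> norm (z r)"
          using c[of r] \<open>r \<in> {s..t}\<close> by auto
        then show ?thesis
          using Z[of r] False \<open>r \<in> {s..t}\<close> \<open>0 \<le> s\<close> by auto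
      qed simp
    qed
    then show ?thesis by simp
  qed
  have small: "norm (z t) < \<delta> / 2" if "t \<ge> 0" for t
  proof (rule ccontr)
    assume "\<not> norm (z t) < \<delta> / 2"
    \<comment> \<open>\<open>Inf T\<close> is the first time at which the barrier is reached. Until
      then the norm cannot have grown, so it is still at most its initial value, which lies below
      the barrier.\<close>
    define T where "T = {0..t} \<inter> (\<lambda>r. norm (z r)) -` {\<delta> / 2..}"
    have "closed T"
      unfolding T_def by (intro continuous_closed_preimage cont[OF that]) auto
    moreover have "bdd_below T" "T \<noteq> {}"
      using \<open>\<not> norm (z t) < \<delta> / 2\<close> that by (auto simp: T_def)
    ultimately have "Inf T \<in> T"
      by (metis closed_contains_Inf)
    then have "0 \<le> Inf T" "norm (z (Inf T)) \<ge> \<delta> / 2"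
      by (auto simp: T_def)
    moreover have "norm (z r) < \<delta> / 2" if "0 \<le> r" "r < Inf T" for r
    proof (rule ccontr)
      assume "\<not> norm (z r) < \<delta> / 2"
      then have "r \<in> T"
        using that \<open>Inf T \<in> T\<close> by (auto simp: T_def)
      then show False
        using cInf_lower[OF _ \<open>bdd_below T\<close>, of r] that by simp
    qed
    ultimately have "(norm (z (Inf T)))\<^sup>2 \<le> (norm (z 0))\<^sup>2"
      using decay[of 0 "Inf T" 0] by simp
    then have "norm (z (Inf T)) \<le> norm (z 0)"
      by (rule power2_le_imp_le) simp
    moreover have "norm (z 0) < \<delta> / 2"
      using z[of 0] x0 by simp
    ultimately show False
      using \<open>norm (z (Inf T)) \<ge> \<delta> / 2\<close> by linarith
  qed
  have mono: "norm (z t) \<le> norm (z r)" if "0 \<le> r" "r \<le> t" for r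
  proof (rule power2_le_imp_le)
    show "(norm (z t))\<^sup>2 \<le> (norm (z r))\<^sup>2"
      using decay[OF that, of 0] small that by simp
  qed simp
  have "(norm (z t))\<^sup>2 - (norm (z s))\<^sup>2 \<le> (t - s) * (- 2 * norm (z t))"
  proof (rule decay)
    fix r assume "s \<le> r" "r < t"
    then show "norm (z r) < \<delta> / 2 \<and> norm (z t) \<le> norm (z r)"
      using small[of r] mono[of r] \<open>0 \<le> s\<close> by simp
  qed (use \<open>0 \<le> s\<close> \<open>s \<le> t\<close> in simp_all)
  then show ?thesis
    by (simp add: z_def algebra_simps)
qed

lemma is_solution_reaches_consensus:
  fixes x0 :: "real^'d^('n::{finite,linorder})"
  assumes a: "\<And>s. 0 < s \<Longrightarrow> s < \<delta> \<Longrightarrow> s * a s \<ge> 2 * (M + 1)"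
    and "u \<in> admissible M" "is_solution a u x0 x" "norm (deviation x0) < \<delta> / 2"
  shows "x \<delta> \<in> consensus"
proof -
  have "x 0 = x0"
    using assms(3) unfolding is_solution_def by auto
  \<comment> \<open>The extinction time is \<open>2 * A\<close> with the initial bound
    \<open>A = \<delta> / 2\<close>.\<close>
  have "norm (deviation (x (2 * (\<delta> / 2)))) = 0"
  proof (rule extinction_by_halving)
    show "norm (deviation (x 0)) \<le> \<delta> / 2"
      using assms(4) \<open>x 0 = x0\<close> by simp
  qed (use is_solution_deviation_decay[OF assms] in auto)
  then show ?thesis
    by (simp add: deviation_eq_0_iff)
qed

section \<open>The neighbourhood of consensus and the strict inclusion\<close>

lemma variance_consensus: "x \<in> consensus \<Longrightarrow> variance x = 0"
  by (simp add: variance_def consensus_iff del: norm_eq_zero)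

theorem theorem1p2:
  fixes a :: "real \<Rightarrow> real"
  assumes "CARD('n::{finite,linorder}) \<ge> 2"
    and "\<forall>s\<ge>0. a s \<ge> 0"
    and "filterlim (\<lambda>s. s * a s) at_top (at_right 0)"
  shows "(\<forall>M>0. \<exists>\<epsilon>>0. \<forall>x0 :: real^'d^('n::{finite,linorder}). (\<forall>i j. norm (x0 $ i - x0 $ j) < \<epsilon>) \<longrightarrow>
            (\<forall>u\<in>admissible M. \<forall>x. is_solution a u x0 x \<longrightarrow> (\<exists>T>0. x T \<in> consensus))) \<and>
         (\<forall>M>0. (consensus :: (real^'d^('n::{finite,linorder})) set) \<subset> black_hole a M)"
proof -
  have main: "\<exists>\<epsilon>>0. \<forall>x0 :: real^'d^('n::{finite,linorder}). (\<forall>i j. norm (x0 $ i - x0 $ j) < \<epsilon>) \<longrightarrow>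
      (\<forall>u\<in>admissible M. \<forall>x. is_solution a u x0 x \<longrightarrow> (\<exists>T>0. x T \<in> consensus))" for M
  proof -
    have "eventually (\<lambda>s. s * a s \<ge> 2 * (M + 1)) (at_right 0)"
      using assms(3) by (simp add: filterlim_at_top)
    then obtain \<delta> where "\<delta> > 0" and \<delta>: "\<And>s. 0 < s \<Longrightarrow> s < \<delta> \<Longrightarrow> s * a s \<ge> 2 * (M + 1)"
      unfolding eventually_at_right_field by auto
    show ?thesis
    proof (intro exI conjI allI impI ballI)
      \<comment> \<open>There are N^2 pairs, and the bound by pair distances divides their sum by N.
        Distances below \<delta>/(2N) therefore keep the deviation below \<delta>/2.\<close>
      show "\<delta> / (2 * real CARD('n)) > 0"
        using \<open>\<delta> > 0\<close> by simp
      fix x0 :: "real^'d^('n::{finite,linorder})" and u x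
      assume x0: "\<forall>i j. norm (x0 $ i - x0 $ j) < \<delta> / (2 * real CARD('n))"
        and "u \<in> admissible M" "is_solution a u x0 x"
      have "(\<Sum>i\<in>UNIV. \<Sum>j\<in>UNIV. norm (x0 $ i - x0 $ j)) <
          (\<Sum>i\<in>(UNIV :: 'n set). \<Sum>j\<in>(UNIV :: 'n set). \<delta> / (2 * real CARD('n)))"
        using x0 by (intro sum_strict_mono) auto
      then have "norm (deviation x0) < (1 / real CARD('n)) * (real CARD('n) * (real CARD('n) * (\<delta> / (2 * real CARD('n)))))"
        by (intro le_less_trans[OF norm_deviation_le] mult_strict_left_mono) auto
      then have "norm (deviation x0) < \<delta> / 2"
        by simp
      from is_solution_reaches_consensus[OF \<delta> \<open>u \<in> admissible M\<close> \<open>is_solution a u x0 x\<close> this]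
      show "x \<delta> \<in> consensus" .
    qed (use \<open>\<delta> > 0\<close> in simp)
  qed
  moreover have "(consensus :: (real^'d^('n::{finite,linorder})) set) \<subset> black_hole a M" for M
  proof -
    obtain \<epsilon> where "\<epsilon> > 0" and \<epsilon>: "\<forall>x0 :: real^'d^('n::{finite,linorder}). (\<forall>i j. norm (x0 $ i - x0 $ j) < \<epsilon>) \<longrightarrow>
        (\<forall>u\<in>admissible M. \<forall>x. is_solution a u x0 x \<longrightarrow> (\<exists>T>0. x T \<in> consensus))"
      using main[of M] by (elim exE conjE)
    have near: "x0 \<in> black_hole a M" if "\<forall>i j. norm (x0 $ i - x0 $ j) < \<epsilon>" for x0 :: "real^'d^('n::{finite,linorder})"
      unfolding black_hole_def
    proof (intro CollectI ballI allI impI)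
      fix u x
      assume "u \<in> admissible M" "is_solution a u x0 x"
      with \<epsilon> that obtain T where "T > 0" "x T \<in> consensus"
        by meson
      then show "\<exists>T>0. variance (x T) = 0"
        using variance_consensus by blast
    qed
    have "\<not> (\<forall>i j :: 'n. i = j)"
    proof
      assume "\<forall>i j :: 'n. i = j"
      then have "(UNIV :: 'n set) \<subseteq> {undefined}" by auto
      then have "CARD('n) \<le> 1"
        using card_mono[of "{undefined :: 'n}"] by simp
      with assms(1) show False by simp
    qed
    then obtain i0 j0 :: 'n where "i0 \<noteq> j0" by blast
    obtain p :: "real^'d" where "norm p = \<epsilon> / 2"
      using vector_choose_size[of "\<epsilon> / 2"] \<open>\<epsilon> > 0\<close> by auto
    \<comment> \<open>Displacing a single agent by half of \<epsilon> leaves consensus but stays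
      within the neighbourhood, which makes the inclusion strict.\<close>
    define x0 :: "real^'d^('n::{finite,linorder})" where "x0 = (\<chi> i. if i = i0 then p else 0)"
    have "norm (x0 $ i - x0 $ j) < \<epsilon>" for i j
      using \<open>\<epsilon> > 0\<close> \<open>norm p = \<epsilon> / 2\<close> by (simp add: x0_def)
    then have "x0 \<in> black_hole a M"
      using near by simp
    moreover have "x0 $ i0 \<noteq> x0 $ j0"
      using \<open>i0 \<noteq> j0\<close> \<open>\<epsilon> > 0\<close> \<open>norm p = \<epsilon> / 2\<close> by (auto simp: x0_def)
    then have "x0 \<notin> consensus"
      by (auto simp: consensus_def)
    moreover have "(consensus :: (real^'d^('n::{finite,linorder})) set) \<subseteq> black_hole a M"
    proof
      fix x :: "real^'d^('n::{finite,linorder})"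
      assume "x \<in> consensus"
      with \<open>\<epsilon> > 0\<close> have "norm (x $ i - x $ j) < \<epsilon>" for i j
        unfolding consensus_iff by metis
      then show "x \<in> black_hole a M"
        using near by blast
    qed
    ultimately show ?thesis by blast
  qed
  ultimately show ?thesis by blast
qed

end
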